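(* Let $K$ be a commutative ring with unit, let $n\ge 1$, and let $A=(a_{ij})$ be a symmetric $n\times n$ matrix with entries in $K$ that is invertible over $K$. Let $V\in K[x^1,\dots,x^n][[\lambda]]$ and $f=f_0+\lambda V$ with $f_0=\frac12 x^tAx$. Let $\Omega$ be the graded module of differential forms in $x^1,\dots,x^n$ with coefficients in $K[x^1,\dots,x^n][[\lambda]]$, and let $Z\subset\Omega$ be the $K[[\lambda]]$-submodule of forms $\rho$ satisfying $d\rho+(df)\rho=0$ (in particular $Z$ contains all $n$-forms). Consider the $K[[\lambda]]$-linear functionals $I:Z\to K[[\lambda]]$ such that $I(dh+(df)h)=0$ for every $h\in\Omega$. Then such a functional is specified up to a constant factor: there is exactly one such functional $I_0$ with the normalization $I_0(dx^1\cdots dx^n)=1$, and every such functional $I$ is of the form $I=c\,I_0$ with $c\in K[[\lambda]]$.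
   Context: The module $\Omega$ is the free graded-commutative exterior algebra on $dx^1,\dots,dx^n$ over $K[x^1,\dots,x^n][[\lambda]]$ (power series in $\lambda$ whose coefficients are polynomials in the $x^i$). The differential $d$ is the de Rham differential in the variables $x^i$ only ($\lambda$ is a constant), and $(df)\rho$ is the exterior product of the one-form $df$ with $\rho$. The twisted differential is $d_f=d+df$; it satisfies $d_f^2=0$. Only the one-form $df$ enters the definitions, so $f$ itself is not required to have coefficients in $K$: $df_0$ denotes the one-form $\sum_{i,j}a_{ij}x^j\,dx^i$, which has coefficients in $K[x^1,\dots,x^n]$ even if $2$ is not invertible in $K$, and $df=df_0+\lambda\,dV$. *)

theory Defs
  imports
    "HOL-Analysis.Analysis"
    "HOL-Library.Poly_Mapping"
    "HOL-Library.FuncSet"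
    "HOL-Computational_Algebra.Formal_Power_Series"
begin

text \<open>
  The finite, linearly ordered type \<open>'n\<close> indexes the coordinates \<open>x\<^sup>1, \<dots>, x\<^sup>n\<close>, so
  \<open>n = CARD('n)\<close>.  A monomial is its exponent vector \<open>'n \<Rightarrow>\<^sub>0 nat\<close>, and the product of
  \<open>('n \<Rightarrow>\<^sub>0 nat) \<Rightarrow>\<^sub>0 'k\<close> is convolution, so this type is the ring \<open>K[x\<^sup>1, \<dots>, x\<^sup>n]\<close>.
\<close>

type_synonym ('n, 'k) mpoly = "('n \<Rightarrow>\<^sub>0 nat) \<Rightarrow>\<^sub>0 'k"

text \<open>The ring \<open>K[x\<^sup>1, \<dots>, x\<^sup>n][[\<lambda>]]\<close>; the parameter \<open>\<lambda>\<close> is \<open>fps_X\<close>.\<close>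

type_synonym ('n, 'k) coeffs = "('n, 'k) mpoly fps"

text \<open>
  The exterior algebra is free over the coefficient ring on the elements \<open>dx\<^sup>S\<close>, \<open>S \<subseteq> {1..n}\<close>,
  where \<open>dx\<^sup>S\<close> is the product of the \<open>dx\<^sup>i\<close>, \<open>i \<in> S\<close>, in increasing order.  The form \<open>\<rho>\<close> is
  represented by its coordinates in this basis: \<open>\<rho> = \<Sum>S. (\<rho> $ S) dx\<^sup>S\<close>.
\<close>

type_synonym ('n, 'k) forms = "('n, 'k) coeffs ^ ('n set)"

definition inversions :: "'n::linorder set \<Rightarrow> 'n set \<Rightarrow> nat" where
  "inversions S T = card {(i, j). i \<in> S \<and> j \<in> T \<and> j < i}"

text \<open>
  The bilinear product with \<open>dx\<^sup>S dx\<^sup>T = (-1)\<^bsup>inversions S T\<^esup> dx\<^bsup>S \<union> T\<^esup>\<close> for disjoint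
  \<open>S\<close>, \<open>T\<close> and \<open>dx\<^sup>S dx\<^sup>T = 0\<close> otherwise.
\<close>

definition wedge :: "('n::{finite,linorder}, 'k::comm_ring_1) forms \<Rightarrow> ('n, 'k) forms \<Rightarrow> ('n, 'k) forms"
    (infixr "\<and>\<^sub>\<Omega>" 72) where
  "\<alpha> \<and>\<^sub>\<Omega> \<beta> = (\<chi> U. \<Sum>S\<in>Pow U. (-1) ^ inversions S (U - S) * (\<alpha> $ S) * (\<beta> $ (U - S)))"

definition function_form :: "('n::{finite,linorder}, 'k::comm_ring_1) coeffs \<Rightarrow> ('n, 'k) forms" where
  "function_form g = axis {} g"

definition dx :: "'n::{finite,linorder} \<Rightarrow> ('n, 'k::comm_ring_1) forms" where
  "dx i = axis {i} 1"

definition volume_form :: "('n::{finite,linorder}, 'k::comm_ring_1) forms" where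
  "volume_form = foldr (\<lambda>i \<omega>. dx i \<and>\<^sub>\<Omega> \<omega>) (sorted_list_of_set UNIV) (function_form 1)"

text \<open>
  When \<open>i\<close> does not occur in \<open>m\<close>, the truncated difference below is harmless because the
  coefficient is zero.
\<close>

definition mpoly_partial :: "'n \<Rightarrow> ('n, 'k::comm_ring_1) mpoly \<Rightarrow> ('n, 'k) mpoly" where
  "mpoly_partial i p =
     (\<Sum>m\<in>Poly_Mapping.keys p.
        Poly_Mapping.single (m - Poly_Mapping.single i 1)
          (of_nat (Poly_Mapping.lookup m i) * Poly_Mapping.lookup p m))"

definition coeff_partial :: "'n \<Rightarrow> ('n, 'k::comm_ring_1) coeffs \<Rightarrow> ('n, 'k) coeffs" where
  "coeff_partial i g = Abs_fps (\<lambda>k. mpoly_partial i (fps_nth g k))"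

definition de_Rham :: "('n::{finite,linorder}, 'k::comm_ring_1) forms \<Rightarrow> ('n, 'k) forms" where
  "de_Rham \<rho> = (\<Sum>i\<in>UNIV. dx i \<and>\<^sub>\<Omega> (\<chi> S. coeff_partial i (\<rho> $ S)))"

text \<open>
  Only the one-form \<open>df\<close> is defined, not \<open>f\<close>, since \<open>f\<^sub>0 = (1/2) x\<^sup>t A x\<close> need not have
  coefficients in \<open>K\<close>: \<open>df = (\<Sum>i j. a\<^sub>i\<^sub>j x\<^sup>j dx\<^sup>i) + \<lambda> dV\<close>.
\<close>

definition df0 :: "'k::comm_ring_1 ^ 'n::{finite,linorder} ^ 'n::{finite,linorder} \<Rightarrow> ('n::{finite,linorder}, 'k) forms" where
  "df0 A = (\<Sum>i\<in>UNIV. \<Sum>j\<in>UNIV.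
     fps_const (Poly_Mapping.single (Poly_Mapping.single j 1) (A $ i $ j)) *s dx i)"

definition df :: "'k::comm_ring_1 ^ 'n::{finite,linorder} ^ 'n::{finite,linorder} \<Rightarrow> ('n::{finite,linorder}, 'k) coeffs \<Rightarrow> ('n, 'k) forms" where
  "df A V = df0 A + fps_X *s de_Rham (function_form V)"

definition twisted_d ::
    "'k::comm_ring_1 ^ 'n::{finite,linorder} ^ 'n::{finite,linorder} \<Rightarrow> ('n::{finite,linorder}, 'k) coeffs \<Rightarrow> ('n, 'k) forms \<Rightarrow> ('n, 'k) forms" where
  "twisted_d A V \<rho> = de_Rham \<rho> + df A V \<and>\<^sub>\<Omega> \<rho>"

definition twisted_closed ::
    "'k::comm_ring_1 ^ 'n::{finite,linorder} ^ 'n::{finite,linorder} \<Rightarrow> ('n::{finite,linorder}, 'k) coeffs \<Rightarrow> ('n, 'k) forms set" where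
  "twisted_closed A V = {\<rho>. twisted_d A V \<rho> = 0}"

text \<open>The inclusion of \<open>K[[\<lambda>]]\<close> into \<open>K[x\<^sup>1, \<dots>, x\<^sup>n][[\<lambda>]]\<close> and the resulting scalar action.\<close>

definition embed_scalar :: "'k::comm_ring_1 fps \<Rightarrow> ('n, 'k) coeffs" where
  "embed_scalar c = Abs_fps (\<lambda>k. Poly_Mapping.single 0 (fps_nth c k))"

definition scale_form ::
    "'k::comm_ring_1 fps \<Rightarrow> ('n::{finite,linorder}, 'k) forms \<Rightarrow> ('n, 'k) forms" where
  "scale_form c \<rho> = embed_scalar c *s \<rho>"

text \<open>
  The \<open>K[[\<lambda>]]\<close>-linear functionals on \<open>Z = twisted_closed A V\<close> vanishing on the image of
  \<open>d + df\<close>.  Functions with domain \<open>Z\<close> are encoded as functions that are extensional on \<open>Z\<close>,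
  so equality of functionals is equality on \<open>Z\<close>.
\<close>

definition integral_functionals ::
    "'k::comm_ring_1 ^ 'n::{finite,linorder} ^ 'n::{finite,linorder} \<Rightarrow> ('n::{finite,linorder}, 'k) coeffs \<Rightarrow> (('n, 'k) forms \<Rightarrow> 'k fps) set" where
  "integral_functionals A V = {I \<in> extensional (twisted_closed A V).
     (\<forall>\<rho>\<in>twisted_closed A V. \<forall>\<sigma>\<in>twisted_closed A V. I (\<rho> + \<sigma>) = I \<rho> + I \<sigma>) \<and>
     (\<forall>c. \<forall>\<rho>\<in>twisted_closed A V. I (scale_form c \<rho>) = c * I \<rho>) \<and>
     (\<forall>h. I (twisted_d A V h) = 0)}"

end

theory Submission
  imports Defs
begin

text \<open>
  Write \<open>D = d + df\<close> and \<open>vol = dx\<^sup>1 \<dots> dx\<^sup>n\<close>.  The theorem says that the cohomology of \<open>D\<close> is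
  a free \<open>K[[\<lambda>]]\<close>-module of rank one generated by the class of \<open>vol\<close>, that is

  \<^item> every \<open>D\<close>-closed form is \<open>c vol + D h\<close> for some \<open>c \<in> K[[\<lambda>]]\<close> (\<open>twisted_d_exact\<close>), and
  \<^item> \<open>c vol = D h\<close> forces \<open>c = 0\<close> (\<open>twisted_d_volume\<close>).

  Given both, \<open>I\<^sub>0\<close> sends \<open>c vol + D h\<close> to \<open>c\<close>; this is well defined and linear, and any functional
  \<open>I\<close> that kills exact forms satisfies \<open>I (c vol + D h) = c I(vol)\<close>.

  The cohomology is computed by two successive perturbations of a Koszul complex.

  The starting point is multiplication by the one-form \<open>df\<^sub>0 = \<Sum>\<^sub>i y\<^sub>i dx\<^sup>i\<close>, \<open>y = A x\<close>, on forms with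
  coefficients in \<open>K[x]\<close>.  The substitution \<open>x \<mapsto> A x\<close> is an automorphism of \<open>K[x]\<close>, because \<open>A\<close> is
  invertible, and it carries the Koszul complex of the variables \<open>x\<^sub>i\<close> to that of the \<open>y\<^sub>i\<close>.  For the
  variables a contracting homotopy, defined monomial by monomial, removes one factor \<open>dx\<^sup>i\<close> together
  with one factor \<open>x\<^sub>i\<close>; it involves no division in \<open>K\<close>.  Only the constant multiples of \<open>vol\<close>
  survive (\<open>koszul_linear_form_exact\<close>).

  Next, \<open>d\<close> lowers the polynomial degree by one whereas \<open>df\<^sub>0\<close> raises it by one.  If the
  \<open>(d + df\<^sub>0)\<close>-differential of a form is constant, the component of highest positive degree of the form
  is therefore Koszul closed, hence Koszul exact, and subtracting a suitable exact form
  lowers the degree.  After finitely many steps the form has constant coefficients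
  (\<open>quadratic_d_reduce\<close>), and there \<open>d\<close> vanishes.

  Finally, \<open>D\<close> reduces to \<open>d + df\<^sub>0\<close> modulo \<open>\<lambda>\<close>, so that the result for \<open>d + df\<^sub>0\<close> can be applied to one
  power of \<open>\<lambda>\<close> after the other (\<open>twisted_d_lambda_step\<close>).

  All three differentials have the shape \<open>\<rho> \<mapsto> \<Sum>\<^sub>i dx\<^sup>i X\<^sub>i(\<rho>)\<close> for commuting additive operators \<open>X\<^sub>i\<close> on
  the coefficients, which is the form in which they are treated below.
\<close>

section \<open>Koszul operators of commuting families\<close>

text \<open>The sign with which \<open>dx\<^sup>i dx\<^bsup>S - {i}\<^esup>\<close> equals \<open>dx\<^sup>S\<close> when \<open>i \<in> S\<close>.\<close>
definition koszul_sign :: "'n::linorder \<Rightarrow> 'n set \<Rightarrow> 'a::comm_ring_1" where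
  "koszul_sign i S = (-1) ^ card {j \<in> S. j < i}"

text \<open>
  The differential \<open>\<rho> \<mapsto> \<Sum>\<^sub>i dx\<^sup>i X\<^sub>i(\<rho>)\<close>.  Taking for \<open>X\<^sub>i\<close> multiplications, partial derivatives or
  their sums gives the Koszul, de Rham and twisted de Rham differentials.
\<close>
definition koszul ::
    "('n::{finite,linorder} \<Rightarrow> 'a \<Rightarrow> 'a::comm_ring_1) \<Rightarrow> 'a ^ 'n set \<Rightarrow> 'a ^ 'n set" where
  "koszul X \<rho> = (\<chi> S. \<Sum>i\<in>S. koszul_sign i S * X i (\<rho> $ (S - {i})))"

lemma koszul_sign_square [simp]: "koszul_sign i S * koszul_sign i S = (1::'a::comm_ring_1)"
  by (simp add: koszul_sign_def flip: power_mult_distrib)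

lemma koszul_sign_cases: "koszul_sign i S = (1::'a::comm_ring_1) \<or> koszul_sign i S = (-1::'a)"
  by (cases "even (card {j \<in> S. j < i})") (auto simp: koszul_sign_def)

lemma koszul_sign_remove_self [simp]: "koszul_sign i (S - {i}) = koszul_sign i S"
proof -
  have "{j \<in> S - {i}. j < i} = {j \<in> S. j < i}" by auto
  then show ?thesis by (simp add: koszul_sign_def)
qed

lemma koszul_sign_insert_self [simp]: "koszul_sign i (insert i S) = koszul_sign i S"
  by (metis koszul_sign_remove_self Diff_insert_absorb insert_absorb)

lemma koszul_sign_empty [simp]: "koszul_sign i {} = 1"
  by (simp add: koszul_sign_def)

text \<open>
  The anticommutation \<open>dx\<^sup>i dx\<^sup>j = - dx\<^sup>j dx\<^sup>i\<close>.
\<close>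
lemma koszul_sign_swap:
  fixes i j :: "'n::{finite,linorder}"
  assumes "i \<in> S" "j \<in> S" "i \<noteq> j"
  shows "koszul_sign i S * koszul_sign j (S - {i}) =
    - (koszul_sign j S * koszul_sign i (S - {j}) :: 'a::comm_ring_1)"
proof -
  have less: "koszul_sign i S * koszul_sign j (S - {i}) =
      - (koszul_sign j S * koszul_sign i (S - {j}) :: 'a)"
    if "i \<in> S" "i < j" for i j
  proof -
    have "{l \<in> S - {j}. l < i} = {l \<in> S. l < i}" using that by auto
    then have 1: "koszul_sign i (S - {j}) = (koszul_sign i S :: 'a)"
      by (simp add: koszul_sign_def)
    have "{l \<in> S. l < j} = insert i {l \<in> S - {i}. l < j}" using that by auto
    then have "card {l \<in> S. l < j} = Suc (card {l \<in> S - {i}. l < j})" by simp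
    then have "koszul_sign j S = - (koszul_sign j (S - {i}) :: 'a)"
      by (simp add: koszul_sign_def)
    then show ?thesis using 1 by simp
  qed
  show ?thesis
    using assms less[of i j] less[of j i] by (cases i j rule: linorder_cases) auto
qed

text \<open>
  Signs pass through maps that are additive without being linear over the coefficient ring, such as
  derivatives, ring homomorphisms and the extraction of homogeneous parts.
\<close>
lemma additive_koszul_sign:
  assumes "Modules.additive (\<phi> :: 'a::comm_ring_1 \<Rightarrow> 'b::comm_ring_1)"
  shows "\<phi> (koszul_sign i S * a) = koszul_sign i S * \<phi> a"
  using koszul_sign_cases[of i S, where 'a='a] 
  by (auto simp: koszul_sign_def additive.minus[OF assms] minus_one_power_iff split: if_splits)

lemma koszul_add:
  assumes "\<And>i. Modules.additive (X i)"
  shows "koszul X (\<rho> + \<sigma>) = koszul X \<rho> + koszul X \<sigma>"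
  by (simp add: koszul_def vec_eq_iff additive.add[OF assms] distrib_left sum.distrib)

lemma koszul_zero:
  assumes "\<And>i. Modules.additive (X i)"
  shows "koszul X 0 = 0"
  by (simp add: koszul_def vec_eq_iff additive.zero[OF assms])

lemma koszul_diff:
  assumes "\<And>i. Modules.additive (X i)"
  shows "koszul X (\<rho> - \<sigma>) = koszul X \<rho> - koszul X \<sigma>"
  by (simp add: koszul_def vec_eq_iff additive.diff[OF assms] right_diff_distrib sum_subtractf)

lemma koszul_axis_UNIV:
  fixes X :: "'n::{finite,linorder} \<Rightarrow> 'a \<Rightarrow> 'a::comm_ring_1"
  assumes "\<And>i. Modules.additive (X i)"
  shows "koszul X (axis UNIV c) = 0"
proof -
  have "axis UNIV c $ (S - {i}) = 0" if "i \<in> S" for i and S :: "'n set"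
    by (auto simp: axis_def)
  then show ?thesis
    by (simp add: koszul_def vec_eq_iff additive.zero[OF assms])
qed

definition map_form :: "('a \<Rightarrow> 'b) \<Rightarrow> 'a ^ 'i \<Rightarrow> 'b ^ 'i" where
  "map_form \<phi> \<rho> = (\<chi> S. \<phi> (\<rho> $ S))"

lemma map_form_nth [simp]: "map_form \<phi> \<rho> $ S = \<phi> (\<rho> $ S)"
  by (simp add: map_form_def)

lemma map_form_axis [simp]: "\<phi> 0 = 0 \<Longrightarrow> map_form \<phi> (axis S a) = axis S (\<phi> a)"
  by (simp add: vec_eq_iff axis_def)

lemma map_form_add:
  assumes "Modules.additive \<phi>"
  shows "map_form \<phi> (\<rho> + \<sigma>) = map_form \<phi> \<rho> + map_form \<phi> \<sigma>"
  by (simp add: vec_eq_iff additive.add[OF assms])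

lemma map_form_diff:
  assumes "Modules.additive \<phi>"
  shows "map_form \<phi> (\<rho> - \<sigma>) = map_form \<phi> \<rho> - map_form \<phi> \<sigma>"
  by (simp add: vec_eq_iff additive.diff[OF assms])

text \<open>
  Two maps \<open>\<phi>\<close> and \<open>\<psi>\<close> are needed because the homogeneous parts intertwine the Koszul differential with a
  shift of the degree.
\<close>
lemma map_form_koszul:
  assumes "Modules.additive \<phi>" and "\<And>i a. \<phi> (X i a) = Y i (\<psi> a)"
  shows "map_form \<phi> (koszul X \<rho>) = koszul Y (map_form \<psi> \<rho>)"
  by (simp add: koszul_def vec_eq_iff additive.sum[OF assms(1)]
      additive_koszul_sign[OF assms(1)] assms(2))

text \<open>
  The contributions of \<open>(i, j)\<close> and \<open>(j, i)\<close> cancel.  They are paired off explicitly, since 2 may be a zero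
  divisor and antisymmetry alone would only give that twice the sum vanishes.
\<close>
lemma koszul_koszul:
  fixes X :: "'n::{finite,linorder} \<Rightarrow> 'a \<Rightarrow> 'a::comm_ring_1"
  assumes add: "\<And>i. Modules.additive (X i)" and comm: "\<And>i j a. X i (X j a) = X j (X i a)"
  shows "koszul X (koszul X \<rho>) = 0"
proof -
  have "(koszul X (koszul X \<rho>)) $ S = 0" for S
  proof -
    define t where "t i j = koszul_sign i S * koszul_sign j (S - {i}) * X i (X j (\<rho> $ (S - {i} - {j})))" for i j
    have swap: "t i j = - t j i" if "i \<in> S" "j \<in> S" "i \<noteq> j" for i j
    proof -
      have "S - {i} - {j} = S - {j} - {i}" by auto
      then show ?thesis
        unfolding t_def koszul_sign_swap[OF that, where 'a='a] by (simp add: comm[of i j])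
    qed
    have "(koszul X (koszul X \<rho>)) $ S = (\<Sum>i\<in>S. \<Sum>j\<in>S - {i}. t i j)"
      by (simp add: koszul_def t_def additive.sum[OF add] additive_koszul_sign[OF add]
          sum_distrib_left mult.assoc)
    also have "\<dots> = (\<Sum>(i, j)\<in>Sigma S (\<lambda>i. S - {i}). t i j)"
      by (simp add: sum.Sigma)
    also have "Sigma S (\<lambda>i. S - {i}) = {(i, j). i \<in> S \<and> j \<in> S \<and> i < j} \<union> {(i, j). i \<in> S \<and> j \<in> S \<and> j < i}"
      by auto
    also have "(\<Sum>(i, j)\<in>\<dots>. t i j) = (\<Sum>(i, j)\<in>{(i, j). i \<in> S \<and> j \<in> S \<and> i < j}. t i j)
        + (\<Sum>(i, j)\<in>{(i, j). i \<in> S \<and> j \<in> S \<and> j < i}. t i j)"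
      by (rule sum.union_disjoint) auto
    also have "(\<Sum>(i, j)\<in>{(i, j). i \<in> S \<and> j \<in> S \<and> j < i}. t i j)
        = (\<Sum>(i, j)\<in>{(i, j). i \<in> S \<and> j \<in> S \<and> i < j}. - t i j)"
      by (rule sum.reindex_bij_witness[where i=prod.swap and j=prod.swap]) (auto intro: swap[symmetric])
    finally show ?thesis
      by (simp add: case_prod_unfold sum_negf)
  qed
  then show ?thesis by (simp add: vec_eq_iff)
qed

text \<open>
  The curvature of the connection \<open>d + \<Sum>\<^sub>i F\<^sub>i dx\<^sup>i\<close> is the exterior derivative of the one-form, which
  vanishes for a closed form.
\<close>
lemma derivation_plus_mult_commute:
  fixes D :: "'n \<Rightarrow> 'a \<Rightarrow> 'a::comm_ring_1"
  assumes add: "\<And>i. Modules.additive (D i)"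
    and Leibniz: "\<And>i a b. D i (a * b) = D i a * b + a * D i b"
    and comm: "\<And>i j a. D i (D j a) = D j (D i a)"
    and closed: "\<And>i j. D i (F j) = D j (F i)"
  shows "D i (D j a + F j * a) + F i * (D j a + F j * a) =
    D j (D i a + F i * a) + F j * (D i a + F i * a)"
  by (simp add: additive.add[OF add] Leibniz comm[of i j] closed[of i j] algebra_simps)

section \<open>Polynomials\<close>

abbreviation coef :: "('n, 'k::comm_ring_1) mpoly \<Rightarrow> ('n \<Rightarrow>\<^sub>0 nat) \<Rightarrow> 'k" where
  "coef \<equiv> Poly_Mapping.lookup"

abbreviation expo :: "('n \<Rightarrow>\<^sub>0 nat) \<Rightarrow> 'n \<Rightarrow> nat" where
  "expo \<equiv> Poly_Mapping.lookup"

abbreviation unit_expo :: "'n \<Rightarrow> ('n \<Rightarrow>\<^sub>0 nat)" where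
  "unit_expo i \<equiv> Poly_Mapping.single i (Suc 0)"

abbreviation const_poly :: "'k::comm_ring_1 \<Rightarrow> ('n, 'k) mpoly" where
  "const_poly c \<equiv> Poly_Mapping.single 0 c"

abbreviation var :: "'n \<Rightarrow> ('n, 'k::comm_ring_1) mpoly" where
  "var i \<equiv> Poly_Mapping.single (unit_expo i) 1"

lemma mpoly_eq_iff: "p = q \<longleftrightarrow> (\<forall>m. Poly_Mapping.lookup p m = Poly_Mapping.lookup q m)"
  by (auto intro: poly_mapping_eqI)

lemma mpoly_induct [case_names single add]:
  fixes p :: "('n, 'k::comm_ring_1) mpoly"
  assumes single: "\<And>m c. P (Poly_Mapping.single m c)" and add: "\<And>p q. P p \<Longrightarrow> P q \<Longrightarrow> P (p + q)"
  shows "P p"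
proof (induction p rule: Poly_Mapping.update_induct)
  case const
  show ?case using single[of 0 0] by simp
next
  case (update f a b)
  have "Poly_Mapping.update a b f = f + Poly_Mapping.single a b"
    using update.hyps by (intro poly_mapping_eqI)
      (auto simp: Poly_Mapping.lookup_update lookup_add lookup_single in_keys_iff when_def)
  then show ?case using add[OF update.IH single] by simp
qed

lemma shift_expo:
  "expo m i \<noteq> 0 \<Longrightarrow> m - unit_expo i + unit_expo i = m"
  by (rule poly_mapping_eqI) (auto simp: lookup_add lookup_minus lookup_single when_def)

lemma coef_var_mult:
  "coef (var i * p) m = (if expo m i = 0 then 0 else coef p (m - unit_expo i))"
proof (induction p rule: mpoly_induct)
  case (single l c)
  have "unit_expo i + l = m \<longleftrightarrow> expo m i \<noteq> 0 \<and> l = m - unit_expo i"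
    using shift_expo[of m i] by (auto simp: lookup_add add.commute)
  then show ?case
    by (auto simp: mult_single lookup_single when_def)
next
  case (add p q)
  then show ?case by (simp add: distrib_left lookup_add)
qed

lemma coef_partial: "coef (mpoly_partial i p) m = of_nat (expo m i + 1) * coef p (m + unit_expo i)"
proof -
  have eq: "l - unit_expo i = m \<and> expo l i \<noteq> 0 \<longleftrightarrow> l = m + unit_expo i" for l
    using shift_expo[of l i] by (auto simp: lookup_add)
  have "coef (mpoly_partial i p) m =
      (\<Sum>l\<in>Poly_Mapping.keys p. if l - unit_expo i = m then of_nat (expo l i) * coef p l else 0)"
    by (simp add: mpoly_partial_def lookup_sum lookup_single when_def)
  also have "\<dots> = (\<Sum>l\<in>Poly_Mapping.keys p. if l = m + unit_expo i then of_nat (expo m i + 1) * coef p (m + unit_expo i) else 0)"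
  proof (intro sum.cong refl)
    fix l
    show "(if l - unit_expo i = m then of_nat (expo l i) * coef p l else 0) =
        (if l = m + unit_expo i then of_nat (expo m i + 1) * coef p (m + unit_expo i) else 0)"
    proof (cases "l = m + unit_expo i")
      case False
      then have "l - unit_expo i = m \<Longrightarrow> expo l i = 0" using eq[of l] by blast
      then show ?thesis using False by simp
    qed (simp add: lookup_add)
  qed
  also have "\<dots> = of_nat (expo m i + 1) * coef p (m + unit_expo i)"
    by (simp add: in_keys_iff)
  finally show ?thesis .
qed

lemma additive_partial: "Modules.additive (mpoly_partial i)"
  by standard (simp add: mpoly_eq_iff coef_partial lookup_add distrib_left)

lemma partial_commute: "mpoly_partial i (mpoly_partial j p) = mpoly_partial j (mpoly_partial i p)"
  by (cases "i = j")
    (simp_all add: mpoly_eq_iff coef_partial lookup_add lookup_single add_ac mult_ac)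

lemma partial_single:
  "mpoly_partial i (Poly_Mapping.single m c) = Poly_Mapping.single (m - unit_expo i) (of_nat (expo m i) * c)"
  by (simp add: mpoly_partial_def)

lemma partial_const [simp]: "mpoly_partial i (const_poly c) = 0"
  by (simp add: partial_single)

lemma partial_mult:
  fixes p q :: "('n, 'k::comm_ring_1) mpoly"
  shows "mpoly_partial i (p * q) = mpoly_partial i p * q + p * mpoly_partial i q"
proof (induction p arbitrary: q rule: mpoly_induct)
  case (single m c)
  show ?case
  proof (induction q rule: mpoly_induct)
    case (single l d)
    have *: "m + l - unit_expo i = (m - unit_expo i) + l" if "expo m i \<noteq> 0" for m l :: "'n \<Rightarrow>\<^sub>0 nat"
      using that by (intro poly_mapping_eqI) (auto simp: lookup_add lookup_minus lookup_single when_def)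
    have 1: "Poly_Mapping.single (m - unit_expo i + l) (of_nat (expo m i) * c * d) =
        Poly_Mapping.single (m + l - unit_expo i) (of_nat (expo m i) * c * d)"
      using *[of m l] by (cases "expo m i = 0") auto
    have 2: "Poly_Mapping.single (m + (l - unit_expo i)) (c * (of_nat (expo l i) * d)) =
        Poly_Mapping.single (m + l - unit_expo i) (c * (of_nat (expo l i) * d))"
      using *[of l m] by (cases "expo l i = 0") (auto simp: add.commute)
    show ?case
      unfolding partial_single mult_single 1 2 by (simp add: lookup_add algebra_simps flip: single_add)
  next
    case (add p q)
    then show ?case by (simp add: distrib_left additive.add[OF additive_partial])
  qed
next
  case (add p p')
  then show ?case by (simp add: distrib_right additive.add[OF additive_partial])
qed


section \<open>The Koszul complex of the variables\<close>

lemma coef_koszul_var: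
  fixes \<rho> :: "('n::{finite,linorder}, 'k::comm_ring_1) mpoly ^ 'n set"
  shows "coef (koszul (\<lambda>i. (*) (var i)) \<rho> $ S) m =
    (\<Sum>j\<in>S. koszul_sign j S * (if expo m j = 0 then 0 else coef (\<rho> $ (S - {j})) (m - unit_expo j)))"
proof -
  have add: "Modules.additive (\<lambda>p :: ('n, 'k) mpoly. coef p m)"
    by standard (simp add: lookup_add)
  show ?thesis
    by (simp add: koszul_def lookup_sum coef_var_mult additive_koszul_sign[OF add] cong: if_cong)
qed

text \<open>
  In the coefficient of \<open>x\<^sup>m dx\<^sup>S\<close>, multiplication by \<open>\<Sum>\<^sub>i x\<^sub>i dx\<^sup>i\<close> adds the same index to \<open>m\<close> and to \<open>S\<close>.
  Call \<open>i\<close> active if \<open>i \<notin> S\<close> or \<open>x\<^sub>i\<close> divides \<open>x\<^sup>m\<close>; the set of active indices is unchanged by this operation.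
  Select one active index \<open>i\<close> for each such set.  On the monomials that share this set the complex is a
  cone in the direction \<open>i\<close>: those with \<open>i \<notin> S\<close> are matched with those with \<open>i \<in> S\<close>, and undoing the
  multiplication by \<open>x\<^sub>i dx\<^sup>i\<close> is a contracting homotopy.  No index is active only for \<open>m = 0\<close> and
  \<open>S\<close> the full set, which leaves the constant multiples of the volume form.
\<close>
lemma koszul_var_exact:
  fixes \<rho> :: "('n::{finite,linorder}, 'k::comm_ring_1) mpoly ^ 'n set"
  assumes closed: "koszul (\<lambda>i. (*) (var i)) \<rho> = 0"
  shows "\<exists>c k. \<rho> = axis UNIV (const_poly c) + koszul (\<lambda>i. (*) (var i)) k"
proof -
  define active where "active S m = {i. i \<notin> S \<or> expo m i \<noteq> 0}" for S :: "'n set" and m :: "'n \<Rightarrow>\<^sub>0 nat"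
  define sel where "sel S m = (SOME i. i \<in> active S m)" for S :: "'n set" and m :: "'n \<Rightarrow>\<^sub>0 nat"
  have sel: "sel S m \<in> active S m" if "active S m \<noteq> {}" for S m
    unfolding sel_def using that by (simp add: some_in_eq)
  have active_step: "active (S - {j}) (m - unit_expo j) = active S m" if "j \<in> S" "expo m j \<noteq> 0" for S m j
    using that by (auto simp: active_def lookup_minus lookup_single when_def)
  \<comment> \<open>The coefficients of the homotopy applied to the form.\<close>
  define h where "h S m = (if sel S m \<in> S then 0
      else koszul_sign (sel S m) S * coef (\<rho> $ insert (sel S m) S) (m + unit_expo (sel S m)))" for S m
  have fin: "finite {m. h S m \<noteq> 0}" for S
  proof (rule finite_subset)
    show "{m. h S m \<noteq> 0} \<subseteq> (\<Union>i. (\<lambda>m. m + unit_expo i) -` Poly_Mapping.keys (\<rho> $ insert i S))"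
    proof
      fix m assume "m \<in> {m. h S m \<noteq> 0}"
      then have "coef (\<rho> $ insert (sel S m) S) (m + unit_expo (sel S m)) \<noteq> 0"
        by (auto simp: h_def split: if_splits)
      then have "m \<in> (\<lambda>m. m + unit_expo (sel S m)) -` Poly_Mapping.keys (\<rho> $ insert (sel S m) S)"
        by (simp add: in_keys_iff)
      then show "m \<in> (\<Union>i. (\<lambda>m. m + unit_expo i) -` Poly_Mapping.keys (\<rho> $ insert i S))"
        by blast
    qed
    show "finite (\<Union>i. (\<lambda>m. m + unit_expo i) -` Poly_Mapping.keys (\<rho> $ insert i S))"
      by (intro finite_UN_I finite_vimageI) (auto simp: inj_def)
  qed
  define k where "k = (\<chi> S. Abs_poly_mapping (h S))"
  have coef_k: "coef (k $ S) m = h S m" for S m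
    using fin by (simp add: k_def)
  define c where "c = coef (\<rho> $ UNIV) 0"
  have "coef (\<rho> $ S) m = coef (axis UNIV (const_poly c) $ S) m + coef (koszul (\<lambda>i. (*) (var i)) k $ S) m" for S m
  proof (cases "active S m = {}")
    case True
    then have "S = UNIV" "expo m i = 0" for i by (auto simp: active_def)
    moreover from this have "m = 0" by (intro poly_mapping_eqI) simp
    ultimately show ?thesis by (simp add: coef_koszul_var c_def)
  next
    case False
    define i where "i = sel S m"
    have i: "i \<in> active S m" using sel[OF False] by (simp add: i_def)
    then have "S \<noteq> UNIV \<or> m \<noteq> 0" by (auto simp: active_def)
    then have axis: "coef (axis UNIV (const_poly c) $ S) m = 0"
      by (auto simp: axis_def lookup_single when_def)
    have h: "h (S - {j}) (m - unit_expo j) = (if i \<in> S - {j} then 0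
        else koszul_sign i (S - {j}) * coef (\<rho> $ insert i (S - {j})) (m - unit_expo j + unit_expo i))"
      if "j \<in> S" "expo m j \<noteq> 0" for j
      using active_step[OF that] by (simp add: h_def sel_def i_def)
    have sum: "coef (koszul (\<lambda>i. (*) (var i)) k $ S) m =
        (\<Sum>j\<in>S. koszul_sign j S * (if expo m j = 0 then 0 else h (S - {j}) (m - unit_expo j)))"
      by (simp add: coef_koszul_var coef_k cong: if_cong)
    show ?thesis
    proof (cases "i \<in> S")
      case True
      then have mi: "expo m i \<noteq> 0" using i by (simp add: active_def)
      have "coef (koszul (\<lambda>i. (*) (var i)) k $ S) m = (\<Sum>j\<in>S. if j = i then coef (\<rho> $ S) m else 0)"
        unfolding sum
      proof (intro sum.cong refl)
        fix j assume j: "j \<in> S"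
        show "koszul_sign j S * (if expo m j = 0 then 0 else h (S - {j}) (m - unit_expo j)) =
          (if j = i then coef (\<rho> $ S) m else 0)"
        proof (cases "j = i")
          case True
          then show ?thesis
            using h[of i] mi j shift_expo[OF mi] by (simp add: insert_absorb flip: mult.assoc)
        next
          case False
          then show ?thesis using h[OF j] \<open>i \<in> S\<close> by simp
        qed
      qed
      then show ?thesis using True axis by simp
    next
      case False
      \<comment> \<open>Here the homotopy does not undo the differential term by term; instead, closedness of the form at
        the index obtained by multiplying with \<open>x\<^sub>i dx\<^sup>i\<close> expresses the coefficient through the others.\<close>
      define T where "T = insert i S"
      have "0 = koszul_sign i S * coef (koszul (\<lambda>i. (*) (var i)) \<rho> $ T) (m + unit_expo i)"
        by (simp add: closed)
      also have "\<dots> = koszul_sign i S * (koszul_sign i S * coef (\<rho> $ S) m) +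
          (\<Sum>j\<in>S. koszul_sign i S * (koszul_sign j T * (if expo (m + unit_expo i) j = 0 then 0
            else coef (\<rho> $ (T - {j})) (m + unit_expo i - unit_expo j))))"
        using False unfolding coef_koszul_var
        by (simp add: T_def lookup_add sum_distrib_left distrib_left)
      also have "(\<Sum>j\<in>S. koszul_sign i S * (koszul_sign j T * (if expo (m + unit_expo i) j = 0 then 0
            else coef (\<rho> $ (T - {j})) (m + unit_expo i - unit_expo j)))) =
          (\<Sum>j\<in>S. - (koszul_sign j S * (if expo m j = 0 then 0 else h (S - {j}) (m - unit_expo j))))"
      proof (intro sum.cong refl)
        fix j assume j: "j \<in> S"
        then have ij: "i \<noteq> j" using False by auto
        have T: "T - {j} = insert i (S - {j})" "T - {i} = S"
          using ij False by (auto simp: T_def)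
        have "koszul_sign i S * koszul_sign j S = - (koszul_sign j T * koszul_sign i (S - {j}) :: 'k)"
          using koszul_sign_swap[of i T j, where 'a='k] j ij
          by (simp add: T) (simp add: T_def)
        then have "koszul_sign i S * koszul_sign j S * (koszul_sign i S * koszul_sign i (S - {j})) =
            - (koszul_sign j T * koszul_sign i (S - {j})) * (koszul_sign i S * koszul_sign i (S - {j}) :: 'k)"
          by simp
        then have "(koszul_sign i S * koszul_sign i S) * (koszul_sign j S * koszul_sign i (S - {j})) =
            - ((koszul_sign i (S - {j}) * koszul_sign i (S - {j})) * (koszul_sign i S * koszul_sign j T :: 'k))"
          by (simp add: ac_simps del: koszul_sign_square)
        then have sign: "koszul_sign j S * koszul_sign i (S - {j}) = - (koszul_sign i S * koszul_sign j T :: 'k)"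
          by simp
        have "expo (m + unit_expo i) j = expo m j" using ij by (simp add: lookup_add lookup_single)
        moreover have "m + unit_expo i - unit_expo j = m - unit_expo j + unit_expo i" if "expo m j \<noteq> 0"
          using that ij by (intro poly_mapping_eqI) (auto simp: lookup_add lookup_minus lookup_single when_def)
        ultimately show "koszul_sign i S * (koszul_sign j T * (if expo (m + unit_expo i) j = 0 then 0
            else coef (\<rho> $ (T - {j})) (m + unit_expo i - unit_expo j))) =
          - (koszul_sign j S * (if expo m j = 0 then 0 else h (S - {j}) (m - unit_expo j)))"
          using h[OF j] False sign by (simp add: T flip: mult.assoc)
      qed
      also have "\<dots> = - coef (koszul (\<lambda>i. (*) (var i)) k $ S) m"
        by (simp add: sum sum_negf)
      finally show ?thesis
        using axis by (simp flip: mult.assoc)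
    qed
  qed
  then have "\<rho> = axis UNIV (const_poly c) + koszul (\<lambda>i. (*) (var i)) k"
    by (simp add: vec_eq_iff mpoly_eq_iff lookup_add)
  then show ?thesis by blast
qed

section \<open>Linear changes of variables\<close>

definition subst :: "('n::finite \<Rightarrow> ('n, 'k) mpoly) \<Rightarrow> ('n, 'k::comm_ring_1) mpoly \<Rightarrow> ('n, 'k) mpoly" where
  "subst s p = (\<Sum>m\<in>Poly_Mapping.keys p. const_poly (coef p m) * (\<Prod>i\<in>UNIV. s i ^ expo m i))"

lemma subst_single: "subst s (Poly_Mapping.single m c) = const_poly c * (\<Prod>i\<in>UNIV. s i ^ expo m i)"
  by (simp add: subst_def)

lemma subst_const [simp]: "subst s (const_poly c) = const_poly c"
  by (simp add: subst_single)

lemma subst_zero [simp]: "subst s 0 = 0"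
  by (simp add: subst_def)

lemma subst_one [simp]: "subst s 1 = 1"
  using subst_const[of s 1] by (simp del: subst_const)

lemma subst_var [simp]: "subst s (var i) = s i"
proof -
  have "(\<Prod>j\<in>UNIV. s j ^ expo (unit_expo i) j) = (\<Prod>j\<in>UNIV. if i = j then s j else 1)"
    by (intro prod.cong) (auto simp: lookup_single when_def)
  then show ?thesis by (simp add: subst_single)
qed

lemma subst_add: "subst s (p + q) = subst s p + subst s q"
  unfolding subst_def
  by (rule Poly_Mapping.setsum_keys_plus_distrib) (simp_all add: single_add distrib_right)

lemma additive_subst: "Modules.additive (subst s)"
  by standard (rule subst_add)

lemma subst_mult: "subst s (p * q) = subst s p * subst s q"
proof (induction p arbitrary: q rule: mpoly_induct)
  case (single m c)
  show ?case
  proof (induction q rule: mpoly_induct)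
    case (single l d)
    have "const_poly (c * d) = const_poly c * (const_poly d :: ('a, 'b) mpoly)"
      by (simp add: mult_single)
    then show ?case
      unfolding mult_single[of m] subst_single by (simp add: lookup_add power_add prod.distrib ac_simps)
  qed (simp add: distrib_left subst_add)
qed (simp add: distrib_right subst_add)

lemma subst_power: "subst s (p ^ k) = subst s p ^ k"
  by (induction k) (simp_all add: subst_mult)

lemma subst_prod: "subst s (\<Prod>i\<in>I. f i) = (\<Prod>i\<in>I. subst s (f i))"
  by (induction I rule: infinite_finite_induct) (simp_all add: subst_mult)

lemma subst_vars: "subst var p = p"
proof (induction p rule: mpoly_induct)
  case (single m c)
  have power: "var i ^ k = (Poly_Mapping.single (Poly_Mapping.single i k) 1 :: ('a, 'b) mpoly)" for i k
    by (induction k) (simp_all add: mult_single flip: single_add)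
  have prod: "(\<Prod>i\<in>I. Poly_Mapping.single (f i) 1) = (Poly_Mapping.single (sum f I) 1 :: ('a, 'b) mpoly)"
    for f and I :: "'a set"
    by (induction I rule: infinite_finite_induct) (simp_all add: mult_single)
  have "(\<Sum>i\<in>UNIV. Poly_Mapping.single i (expo m i)) = m"
    by (rule poly_mapping_eqI) (simp add: lookup_sum lookup_single when_def)
  then show ?case
    by (simp add: subst_single power prod mult_single)
qed (simp add: subst_add)

text \<open>
  Ring endomorphisms of \<open>K[x]\<close> over \<open>K\<close> are determined by the images of the variables.
\<close>
lemma subst_inverse:
  assumes "\<And>i. subst s (t i) = var i"
  shows "subst s (subst t p) = p"
proof (induction p rule: mpoly_induct)
  case (single m c)
  have "subst s (subst t (Poly_Mapping.single m c)) = subst var (Poly_Mapping.single m c)"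
    by (simp add: subst_single subst_mult subst_prod subst_power assms)
  then show ?case by (simp add: subst_vars)
qed (simp add: subst_add)

definition linear_form :: "'k::comm_ring_1 ^ 'n ^ 'n \<Rightarrow> 'n \<Rightarrow> ('n::finite, 'k) mpoly" where
  "linear_form A i = (\<Sum>j\<in>UNIV. Poly_Mapping.single (unit_expo j) (A $ i $ j))"

lemma linear_form_eq: "linear_form A i = (\<Sum>j\<in>UNIV. const_poly (A $ i $ j) * var j)"
  by (simp add: linear_form_def mult_single)

lemma linear_form_mat_1: "linear_form (mat 1) i = var i"
proof -
  have "linear_form (mat 1) i = (\<Sum>j\<in>UNIV. if i = j then var j else 0)"
    unfolding linear_form_def by (intro sum.cong) (auto simp: mat_def)
  then show ?thesis by simp
qed

lemma subst_linear_form: "subst (linear_form B) (linear_form A i) = linear_form (A ** B) i"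
proof -
  have "subst (linear_form B) (linear_form A i) =
      (\<Sum>j\<in>UNIV. \<Sum>l\<in>UNIV. Poly_Mapping.single (unit_expo l) (A $ i $ j * B $ j $ l))"
    unfolding linear_form_eq[of A] additive.sum[OF additive_subst] subst_mult subst_const subst_var
    by (simp add: linear_form_def sum_distrib_left mult_single)
  also have "\<dots> = linear_form (A ** B) i"
    unfolding linear_form_def matrix_matrix_mult_def
    by (subst sum.swap) (simp add: additive.sum[of "Poly_Mapping.single _"] Modules.additive_def single_add)
  finally show ?thesis .
qed

text \<open>
  The change of variables acts on the coefficients only and leaves the \<open>dx\<^sup>i\<close> alone.  It takes \<open>\<Sum>\<^sub>i y\<^sub>i dx\<^sup>i\<close>
  to \<open>\<Sum>\<^sub>i x\<^sub>i dx\<^sup>i\<close>, so that the Koszul differentials correspond, and no transformation of the exterior algebra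
  is needed.
\<close>
lemma koszul_linear_form_exact:
  fixes A :: "'k::comm_ring_1 ^ 'n::{finite,linorder} ^ 'n::{finite,linorder}"
  assumes "invertible A" and closed: "koszul (\<lambda>i. (*) (linear_form A i)) \<rho> = 0"
  shows "\<exists>c k. \<rho> = axis UNIV (const_poly c) + koszul (\<lambda>i. (*) (linear_form A i)) k"
proof -
  obtain B where AB: "A ** B = mat 1" and BA: "B ** A = mat 1"
    using assms(1) by (auto simp: invertible_def)
  let ?\<phi> = "subst (linear_form B)" and ?\<psi> = "subst (linear_form A)"
  have "koszul (\<lambda>i. (*) (var i)) (map_form ?\<phi> \<rho>) = map_form ?\<phi> (koszul (\<lambda>i. (*) (linear_form A i)) \<rho>)"
    by (rule map_form_koszul[symmetric])
      (simp_all add: additive_subst subst_mult subst_linear_form AB linear_form_mat_1)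
  also have "\<dots> = 0" by (simp add: closed vec_eq_iff)
  finally obtain c k where *: "map_form ?\<phi> \<rho> = axis UNIV (const_poly c) + koszul (\<lambda>i. (*) (var i)) k"
    using koszul_var_exact by blast
  have "\<rho> = map_form ?\<psi> (map_form ?\<phi> \<rho>)"
    by (simp add: vec_eq_iff subst_inverse subst_linear_form BA linear_form_mat_1)
  also have "\<dots> = map_form ?\<psi> (axis UNIV (const_poly c)) + map_form ?\<psi> (koszul (\<lambda>i. (*) (var i)) k)"
    unfolding * by (simp add: vec_eq_iff subst_add del: map_form_axis)
  also have "map_form ?\<psi> (koszul (\<lambda>i. (*) (var i)) k) = koszul (\<lambda>i. (*) (linear_form A i)) (map_form ?\<psi> k)"
    by (rule map_form_koszul) (simp_all add: additive_subst subst_mult)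
  also have "map_form ?\<psi> (axis UNIV (const_poly c)) = axis UNIV (const_poly c)"
    by simp
  finally show ?thesis by blast
qed


section \<open>The twisted de Rham complex of a quadratic form\<close>

definition total_degree :: "('n::finite \<Rightarrow>\<^sub>0 nat) \<Rightarrow> nat" where
  "total_degree m = (\<Sum>i\<in>UNIV. expo m i)"

lemma total_degree_add: "total_degree (m + l) = total_degree m + total_degree l"
  by (simp add: total_degree_def lookup_add sum.distrib)

lemma total_degree_unit [simp]: "total_degree (unit_expo i) = 1"
  by (simp add: total_degree_def lookup_single when_def)

lemma total_degree_eq_0 [simp]: "total_degree m = 0 \<longleftrightarrow> m = 0"
  by (auto simp: total_degree_def mpoly_eq_iff)

lemma total_degree_zero [simp]: "total_degree 0 = 0"
  by simp

lemma total_degree_pos [simp]: "0 < total_degree m \<longleftrightarrow> m \<noteq> 0"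
  using total_degree_eq_0[of m] by linarith

lemma total_degree_remove:
  "expo m i \<noteq> 0 \<Longrightarrow> total_degree m = Suc (total_degree (m - unit_expo i))"
  using total_degree_add[of "m - unit_expo i" "unit_expo i"] shift_expo[of m i] by simp

definition homogeneous_part :: "nat \<Rightarrow> ('n::finite, 'k::comm_ring_1) mpoly \<Rightarrow> ('n, 'k) mpoly" where
  "homogeneous_part N p = Poly_Mapping.mapp (\<lambda>m c. c when total_degree m = N) p"

lemma coef_homogeneous_part: "coef (homogeneous_part N p) m = (if total_degree m = N then coef p m else 0)"
  by (auto simp: homogeneous_part_def lookup_mapp when_def in_keys_iff)

lemma additive_homogeneous_part: "Modules.additive (homogeneous_part N)"
  by standard (simp add: mpoly_eq_iff coef_homogeneous_part lookup_add)

definition degree_less :: "nat \<Rightarrow> ('n::finite, 'k::comm_ring_1) mpoly ^ 'i \<Rightarrow> bool" where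
  "degree_less N \<rho> \<longleftrightarrow> (\<forall>S m. N \<le> total_degree m \<longrightarrow> coef (\<rho> $ S) m = 0)"

lemma degree_less_mono: "degree_less N \<rho> \<Longrightarrow> N \<le> M \<Longrightarrow> degree_less M \<rho>"
  by (auto simp: degree_less_def)

lemma degree_less_add: "degree_less N \<rho> \<Longrightarrow> degree_less N \<sigma> \<Longrightarrow> degree_less N (\<rho> + \<sigma>)"
  by (auto simp: degree_less_def lookup_add)

lemma degree_less_diff: "degree_less N \<rho> \<Longrightarrow> degree_less N \<sigma> \<Longrightarrow> degree_less N (\<rho> - \<sigma>)"
  by (auto simp: degree_less_def lookup_minus)

lemma degree_less_Suc:
  "degree_less N \<rho> \<longleftrightarrow> degree_less (Suc N) \<rho> \<and> map_form (homogeneous_part N) \<rho> = 0"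
  by (auto simp: degree_less_def vec_eq_iff mpoly_eq_iff coef_homogeneous_part
      Suc_le_eq nat_less_le)

lemma degree_less_exists: "\<exists>N. degree_less N (\<rho> :: ('n::finite, 'k::comm_ring_1) mpoly ^ 'i::finite)"
proof -
  define M where "M = (\<Union>S. Poly_Mapping.keys (\<rho> $ S))"
  have "finite M" by (simp add: M_def)
  have "degree_less (Suc (Max (insert 0 (total_degree ` M)))) \<rho>"
    unfolding degree_less_def
  proof (intro allI impI, rule ccontr)
    fix S m assume le: "Suc (Max (insert 0 (total_degree ` M))) \<le> total_degree m" and "coef (\<rho> $ S) m \<noteq> 0"
    then have "m \<in> M" by (auto simp: M_def in_keys_iff)
    then have "total_degree m \<le> Max (insert 0 (total_degree ` M))"
      using \<open>finite M\<close> by (intro Max_ge) auto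
    with le show False by simp
  qed
  then show ?thesis ..
qed

lemma additive_mult: "Modules.additive ((*) (a :: 'a::comm_ring_1))"
  by standard (simp add: distrib_left)

lemma additive_partial_plus_mult: "Modules.additive (\<lambda>p. mpoly_partial i p + a * p)"
  by standard (simp add: additive.add[OF additive_partial] distrib_left)

lemma coef_linear_form_mult:
  fixes A :: "'k::comm_ring_1 ^ 'n::finite ^ 'n::finite"
  shows "coef (linear_form A i * p) m =
    (\<Sum>j\<in>UNIV. A $ i $ j * (if expo m j = 0 then 0 else coef p (m - unit_expo j)))"
proof -
  have const: "coef (const_poly a * q) m = a * coef q m" for a and q :: "('n, 'k) mpoly"
    by (induction q rule: mpoly_induct)
      (auto simp: mult_single lookup_single when_def distrib_left lookup_add)
  show ?thesis
    by (simp add: linear_form_eq sum_distrib_right lookup_sum mult.assoc const coef_var_mult cong: if_cong)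
qed

lemma homogeneous_part_linear_form_mult:
  "homogeneous_part (Suc N) (linear_form A i * p) = linear_form A i * homogeneous_part N p"
  by (intro poly_mapping_eqI)
    (auto simp: coef_homogeneous_part coef_linear_form_mult total_degree_remove
      intro!: sum.cong sum.neutral)

lemma homogeneous_part_0_linear_form_mult:
  "homogeneous_part 0 (linear_form A i * p) = 0"
  by (intro poly_mapping_eqI) (auto simp: coef_homogeneous_part coef_linear_form_mult)

lemma partial_linear_form: "mpoly_partial i (linear_form A j) = const_poly (A $ j $ i)"
proof -
  have "mpoly_partial i (Poly_Mapping.single (unit_expo l) a) = (if l = i then const_poly a else 0)" for l and a :: 'b
    by (auto simp: partial_single lookup_single)
  then have "mpoly_partial i (linear_form A j) = (\<Sum>l\<in>UNIV. if l = i then const_poly (A $ j $ l) else 0)"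
    by (simp add: linear_form_def additive.sum[OF additive_partial])
  then show ?thesis by simp
qed

lemma symmetric_entries:
  assumes "transpose A = A"
  shows "A $ i $ j = A $ j $ i"
  using arg_cong[OF assms, of "\<lambda>M. M $ i $ j"] by (simp add: transpose_def)

text \<open>
  The differential \<open>d + df\<^sub>0\<close> on forms with coefficients in \<open>K[x]\<close>, which is the reduction of
  \<open>d + df\<close> modulo \<open>\<lambda>\<close>.
\<close>
definition quadratic_d ::
    "'k::comm_ring_1 ^ 'n::{finite,linorder} ^ 'n::{finite,linorder} \<Rightarrow>
      ('n, 'k) mpoly ^ 'n set \<Rightarrow> ('n, 'k) mpoly ^ 'n set" where
  "quadratic_d A = koszul (\<lambda>i p. mpoly_partial i p + linear_form A i * p)"

lemma quadratic_d_split: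
  "quadratic_d A \<rho> = koszul mpoly_partial \<rho> + koszul (\<lambda>i. (*) (linear_form A i)) \<rho>"
  by (simp add: quadratic_d_def koszul_def vec_eq_iff distrib_left sum.distrib)

lemma quadratic_d_diff: "quadratic_d A (\<rho> - \<sigma>) = quadratic_d A \<rho> - quadratic_d A \<sigma>"
  unfolding quadratic_d_def by (rule koszul_diff) (rule additive_partial_plus_mult)

lemma quadratic_d_zero: "quadratic_d A 0 = 0"
  unfolding quadratic_d_def by (rule koszul_zero) (rule additive_partial_plus_mult)

lemma quadratic_d_add: "quadratic_d A (\<rho> + \<sigma>) = quadratic_d A \<rho> + quadratic_d A \<sigma>"
  unfolding quadratic_d_def by (rule koszul_add) (rule additive_partial_plus_mult)

text \<open>
  Symmetry of \<open>A\<close> is the closedness of the one-form \<open>df\<^sub>0\<close>.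
\<close>
lemma quadratic_d_square:
  assumes "transpose A = A"
  shows "quadratic_d A (quadratic_d A \<rho>) = 0"
  unfolding quadratic_d_def
  by (intro koszul_koszul additive_partial_plus_mult derivation_plus_mult_commute)
    (simp_all add: additive_partial partial_mult partial_commute partial_linear_form
      symmetric_entries[OF assms])

lemma degree_less_koszul_partial:
  assumes "degree_less (Suc N) \<rho>"
  shows "degree_less N (koszul mpoly_partial \<rho>)"
proof -
  have "coef (koszul_sign i S * mpoly_partial i (\<rho> $ (S - {i}))) m = 0" if "N \<le> total_degree m" for i S m
  proof -
    have "mpoly_partial i (\<rho> $ (S - {i})) = q \<Longrightarrow> coef (koszul_sign i S * q) m = 0" for q
      using koszul_sign_cases[of i S, where 'a="('a, 'b) mpoly"] that assms
        coef_partial[of i "\<rho> $ (S - {i})" m]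
      by (auto simp: degree_less_def total_degree_add)
    then show ?thesis by simp
  qed
  then show ?thesis
    by (simp add: degree_less_def koszul_def lookup_sum)
qed

lemma homogeneous_part_koszul_linear_form:
  "map_form (homogeneous_part (Suc N)) (koszul (\<lambda>i. (*) (linear_form A i)) \<rho>) =
    koszul (\<lambda>i. (*) (linear_form A i)) (map_form (homogeneous_part N) \<rho>)"
  by (rule map_form_koszul) (simp_all add: additive_homogeneous_part homogeneous_part_linear_form_mult)

lemma homogeneous_part_0_koszul_linear_form:
  "map_form (homogeneous_part 0) (koszul (\<lambda>i. (*) (linear_form A i)) \<rho>) = 0"
proof -
  have "map_form (homogeneous_part 0) (koszul (\<lambda>i. (*) (linear_form A i)) \<rho>) =
      koszul (\<lambda>i p. 0) (map_form (homogeneous_part 0) \<rho>)"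
    by (rule map_form_koszul) (simp_all add: additive_homogeneous_part homogeneous_part_0_linear_form_mult)
  then show ?thesis by (simp add: koszul_def vec_eq_iff)
qed

lemma homogeneous_part_const:
  "homogeneous_part N (const_poly c) = (if N = 0 then const_poly c else 0)"
  by (intro poly_mapping_eqI) (auto simp: coef_homogeneous_part lookup_single when_def)

text \<open>
  Descent on the degree.  If \<open>\<rho>\<close> has highest component \<open>\<rho>\<^sub>N\<close> with \<open>N > 0\<close>, the component of degree \<open>N + 1\<close> of
  its differential is the Koszul differential of \<open>\<rho>\<^sub>N\<close>, which vanishes by hypothesis.  So \<open>\<rho>\<^sub>N\<close> is the Koszul
  differential of some \<open>k\<close> of degree \<open>N - 1\<close>, and \<open>\<rho> - (d + df\<^sub>0) k\<close> has smaller degree with the same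
  differential.  The hypothesis covers both closed forms and primitives of multiples of the volume form.
\<close>
lemma quadratic_d_reduce:
  fixes A :: "'k::comm_ring_1 ^ 'n::{finite,linorder} ^ 'n::{finite,linorder}"
  assumes "transpose A = A" "invertible A" "degree_less 1 (quadratic_d A \<rho>)"
  shows "\<exists>k. degree_less 1 (\<rho> - quadratic_d A k)"
proof -
  let ?\<delta> = "koszul (\<lambda>i. (*) (linear_form A i)) :: ('n, 'k) mpoly ^ 'n set \<Rightarrow> _"
  have "\<exists>k. degree_less 1 (\<rho> - quadratic_d A k)"
    if "degree_less (Suc N) \<rho>" "degree_less 1 (quadratic_d A \<rho>)" for N \<rho>
    using that
  proof (induction N arbitrary: \<rho>)
    case 0
    then have "degree_less 1 (\<rho> - quadratic_d A 0)"
      by (simp add: quadratic_d_zero)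
    then show ?case ..
  next
    case (Suc N)
    let ?top = "map_form (homogeneous_part (Suc N)) \<rho>"
    have "degree_less (Suc N) (koszul mpoly_partial \<rho>)"
      using Suc.prems(1) by (rule degree_less_koszul_partial)
    moreover have "degree_less (Suc (Suc N)) (quadratic_d A \<rho>)"
      using Suc.prems(2) by (rule degree_less_mono) simp
    ultimately have "map_form (homogeneous_part (Suc (Suc N))) (koszul mpoly_partial \<rho>) = 0"
      "map_form (homogeneous_part (Suc (Suc N))) (quadratic_d A \<rho>) = 0"
      using degree_less_Suc degree_less_mono[of "Suc N" _ "Suc (Suc N)"] by auto
    then have "?\<delta> ?top = 0"
      by (simp add: quadratic_d_split map_form_add additive_homogeneous_part
          homogeneous_part_koszul_linear_form)
    from koszul_linear_form_exact[OF assms(2) this]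
    obtain c k where k: "?top = axis UNIV (const_poly c) + ?\<delta> k" by blast
    \<comment> \<open>In positive degree the multiple of the volume form is absent, and only one component of \<open>k\<close>
      contributes.\<close>
    define k' where "k' = map_form (homogeneous_part N) k"
    have "?top = map_form (homogeneous_part (Suc N)) ?top"
      by (simp add: vec_eq_iff mpoly_eq_iff coef_homogeneous_part)
    also have "\<dots> = ?\<delta> k'"
      unfolding k map_form_add[OF additive_homogeneous_part] homogeneous_part_koszul_linear_form k'_def
      by (simp add: homogeneous_part_const additive.zero[OF additive_homogeneous_part])
    finally have top: "?top = ?\<delta> k'" .
    have k'_less: "degree_less (Suc N) k'"
      by (auto simp: degree_less_def k'_def coef_homogeneous_part)
    have partial_less: "degree_less N (koszul mpoly_partial k')"
      using k'_less by (rule degree_less_koszul_partial)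
    have \<delta>_less: "degree_less (Suc (Suc N)) (?\<delta> k')"
      unfolding top[symmetric] by (auto simp: degree_less_def coef_homogeneous_part)
    have "degree_less (Suc (Suc N)) (\<rho> - quadratic_d A k')"
      unfolding quadratic_d_split
      by (intro degree_less_diff degree_less_add Suc.prems(1) \<delta>_less degree_less_mono[OF partial_less]) simp
    moreover have "map_form (homogeneous_part (Suc N)) (\<rho> - quadratic_d A k') = 0"
    proof -
      have "map_form (homogeneous_part (Suc N)) (koszul mpoly_partial k') = 0"
        using partial_less
        by (auto simp: degree_less_def vec_eq_iff mpoly_eq_iff coef_homogeneous_part)
      moreover have "map_form (homogeneous_part (Suc N)) (?\<delta> k') = ?\<delta> k'"
        unfolding top[symmetric]
        by (simp add: vec_eq_iff mpoly_eq_iff coef_homogeneous_part)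
      ultimately show ?thesis
        by (simp add: quadratic_d_split map_form_add map_form_diff additive_homogeneous_part top)
    qed
    ultimately have "degree_less (Suc N) (\<rho> - quadratic_d A k')"
      by (simp add: degree_less_Suc[of "Suc N"])
    moreover have "quadratic_d A (\<rho> - quadratic_d A k') = quadratic_d A \<rho>"
      by (simp add: quadratic_d_diff quadratic_d_square assms(1))
    ultimately obtain k'' where "degree_less 1 (\<rho> - quadratic_d A k' - quadratic_d A k'')"
      using Suc.IH[of "\<rho> - quadratic_d A k'"] Suc.prems(2) by auto
    moreover have "\<rho> - quadratic_d A k' - quadratic_d A k'' = \<rho> - quadratic_d A (k' + k'')"
      by (simp add: quadratic_d_add)
    ultimately show ?case by auto
  qed
  moreover obtain N where "degree_less N \<rho>" using degree_less_exists by blast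
  ultimately show ?thesis using assms(3) degree_less_mono[of N \<rho> "Suc N"] by auto
qed

lemma quadratic_d_degree_0:
  assumes "degree_less 1 \<rho>"
  shows "quadratic_d A \<rho> = koszul (\<lambda>i. (*) (linear_form A i)) \<rho>"
proof -
  have "degree_less 0 (koszul mpoly_partial \<rho>)"
    using assms by (intro degree_less_koszul_partial) simp
  then have "koszul mpoly_partial \<rho> = 0"
    by (simp add: degree_less_def vec_eq_iff mpoly_eq_iff)
  then show ?thesis by (simp add: quadratic_d_split)
qed

text \<open>
  A closed form may be taken to have constant coefficients.  It is then Koszul closed, and Koszul
  exact forms have no component of degree 0.
\<close>
lemma quadratic_d_exact:
  fixes A :: "'k::comm_ring_1 ^ 'n::{finite,linorder} ^ 'n::{finite,linorder}"
  assumes "transpose A = A" "invertible A" "quadratic_d A \<rho> = 0"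
  shows "\<exists>c k. \<rho> = axis UNIV (const_poly c) + quadratic_d A k"
proof -
  have "degree_less 1 (quadratic_d A \<rho>)" using assms(3) by (simp add: degree_less_def)
  from quadratic_d_reduce[OF assms(1,2) this]
  obtain k where k: "degree_less 1 (\<rho> - quadratic_d A k)" by blast
  have "koszul (\<lambda>i. (*) (linear_form A i)) (\<rho> - quadratic_d A k) = 0"
    using quadratic_d_degree_0[OF k, of A] by (simp add: quadratic_d_diff assms quadratic_d_square)
  from koszul_linear_form_exact[OF assms(2) this] obtain c l where
    l: "\<rho> - quadratic_d A k = axis UNIV (const_poly c) + koszul (\<lambda>i. (*) (linear_form A i)) l" by blast
  have "\<rho> - quadratic_d A k = map_form (homogeneous_part 0) (\<rho> - quadratic_d A k)"
    using k by (auto simp: degree_less_def vec_eq_iff coef_homogeneous_part Suc_le_eq intro!: poly_mapping_eqI)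
  also have "\<dots> = axis UNIV (const_poly c)"
    unfolding l map_form_add[OF additive_homogeneous_part] homogeneous_part_0_koszul_linear_form
    by (simp add: homogeneous_part_const additive.zero[OF additive_homogeneous_part])
  finally have "\<rho> = axis UNIV (const_poly c) + quadratic_d A k"
    by (simp add: algebra_simps)
  then show ?thesis by blast
qed

text \<open>
  The primitive may be taken to have constant coefficients, and then its differential is of degree 1.
\<close>
lemma quadratic_d_volume:
  fixes A :: "'k::comm_ring_1 ^ 'n::{finite,linorder} ^ 'n::{finite,linorder}"
  assumes "transpose A = A" "invertible A" "quadratic_d A \<rho> = axis UNIV (const_poly c)"
  shows "c = 0"
proof -
  have less: "degree_less 1 (axis UNIV (const_poly c) :: ('n, 'k) mpoly ^ 'n set)"
    by (auto simp: degree_less_def axis_def lookup_single when_def)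
  with assms(3) obtain k where k: "degree_less 1 (\<rho> - quadratic_d A k)"
    using quadratic_d_reduce[OF assms(1,2)] by metis
  have "axis UNIV (const_poly c) = koszul (\<lambda>i. (*) (linear_form A i)) (\<rho> - quadratic_d A k)"
    using quadratic_d_degree_0[OF k, of A] by (simp add: quadratic_d_diff assms quadratic_d_square)
  then have "map_form (homogeneous_part 0) (axis UNIV (const_poly c)) = (0 :: ('n, 'k) mpoly ^ 'n set)"
    by (simp add: homogeneous_part_0_koszul_linear_form del: map_form_axis)
  then have "axis UNIV (const_poly c) = (0 :: ('n, 'k) mpoly ^ 'n set)"
    by (simp add: homogeneous_part_const additive.zero[OF additive_homogeneous_part])
  then have "(const_poly c :: ('n, 'k) mpoly) = 0"
    by (metis axis_nth zero_index)
  then show ?thesis by (metis lookup_single_eq lookup_zero)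
qed


section \<open>The twisted de Rham complex over the power series ring\<close>

lemma coeff_partial_nth [simp]: "fps_nth (coeff_partial i g) k = mpoly_partial i (fps_nth g k)"
  by (simp add: coeff_partial_def)

lemma additive_coeff_partial: "Modules.additive (coeff_partial i)"
  by standard (simp add: fps_eq_iff additive.add[OF additive_partial])

lemma coeff_partial_mult: "coeff_partial i (f * g) = coeff_partial i f * g + f * coeff_partial i g"
  by (simp add: fps_eq_iff fps_mult_nth additive.sum[OF additive_partial] partial_mult sum.distrib)

lemma coeff_partial_commute: "coeff_partial i (coeff_partial j g) = coeff_partial j (coeff_partial i g)"
  by (simp add: fps_eq_iff partial_commute)

lemma coeff_partial_embed_scalar [simp]: "coeff_partial i (embed_scalar c) = 0"
  by (simp add: fps_eq_iff embed_scalar_def)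

lemma embed_scalar_nth [simp]: "fps_nth (embed_scalar c) k = const_poly (fps_nth c k)"
  by (simp add: embed_scalar_def)

lemma embed_scalar_add: "embed_scalar (c + d) = embed_scalar c + embed_scalar d"
  by (simp add: fps_eq_iff single_add)

lemma embed_scalar_1 [simp]: "embed_scalar 1 = 1"
  by (simp add: fps_eq_iff fps_one_def)

lemma embed_scalar_0 [simp]: "embed_scalar 0 = 0"
  by (simp add: fps_eq_iff)

lemma embed_scalar_mult: "embed_scalar (c * d) = embed_scalar c * embed_scalar d"
proof -
  have add: "Modules.additive (\<lambda>c. const_poly c)" by standard (simp add: single_add)
  show ?thesis
    by (simp add: fps_eq_iff fps_mult_nth additive.sum[OF add] mult_single)
qed

lemma embed_scalar_X: "embed_scalar fps_X = fps_X"
  by (simp add: fps_eq_iff fps_X_def)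

lemma coeff_partial_X: "coeff_partial i fps_X = 0"
  unfolding embed_scalar_X[symmetric] by (rule coeff_partial_embed_scalar)

lemma inversions_singleton: "(-1) ^ inversions {i} (U - {i}) = koszul_sign i U"
proof -
  have "{(i', j). i' \<in> {i} \<and> j \<in> U - {i} \<and> j < i'} = Pair i ` {j \<in> U. j < i}" by auto
  then have "inversions {i} (U - {i}) = card {j \<in> U. j < i}"
    unfolding inversions_def by (simp add: card_image inj_on_def)
  then show ?thesis by (simp add: koszul_sign_def)
qed

lemma wedge_one_form: "(\<Sum>i\<in>UNIV. F i *s dx i) \<and>\<^sub>\<Omega> \<rho> = koszul (\<lambda>i. (*) (F i)) \<rho>"
proof -
  have comp: "(\<Sum>i\<in>UNIV. F i *s dx i) $ S = (\<Sum>i\<in>UNIV. if S = {i} then F i else 0)" for S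
    by (auto simp: dx_def axis_def intro!: sum.cong)
  have "((\<Sum>i\<in>UNIV. F i *s dx i) \<and>\<^sub>\<Omega> \<rho>) $ U = koszul (\<lambda>i. (*) (F i)) \<rho> $ U" for U
  proof -
    have "((\<Sum>i\<in>UNIV. F i *s dx i) \<and>\<^sub>\<Omega> \<rho>) $ U =
      (\<Sum>i\<in>UNIV. \<Sum>S\<in>Pow U. if S = {i} then koszul_sign i U * F i * \<rho> $ (U - {i}) else 0)"
      unfolding wedge_def comp vec_lambda_beta sum_distrib_left sum_distrib_right
      by (subst sum.swap) (auto intro!: sum.cong simp: inversions_singleton)
    also have "\<dots> = (\<Sum>i\<in>UNIV. if i \<in> U then koszul_sign i U * F i * \<rho> $ (U - {i}) else 0)"
      by (intro sum.cong) auto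
    also have "\<dots> = koszul (\<lambda>i. (*) (F i)) \<rho> $ U"
      by (simp add: koszul_def mult.assoc sum.If_cases)
    finally show ?thesis .
  qed
  then show ?thesis by (simp add: vec_eq_iff)
qed

lemma wedge_dx: "dx i \<and>\<^sub>\<Omega> \<rho> = (\<chi> U. if i \<in> U then koszul_sign i U * \<rho> $ (U - {i}) else 0)"
proof -
  have "(\<Sum>S\<in>Pow U. (-1) ^ inversions S (U - S) * dx i $ S * \<rho> $ (U - S)) =
      (\<Sum>S\<in>Pow U. if S = {i} then koszul_sign i U * \<rho> $ (U - {i}) else 0)" for U
    by (intro sum.cong) (auto simp: dx_def axis_def inversions_singleton)
  then show ?thesis by (simp add: wedge_def vec_eq_iff)
qed

lemma de_Rham_eq_koszul: "de_Rham \<rho> = koszul coeff_partial \<rho>"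
  by (simp add: de_Rham_def wedge_dx koszul_def vec_eq_iff sum.If_cases)

lemma de_Rham_function_form: "de_Rham (function_form V) = (\<Sum>i\<in>UNIV. coeff_partial i V *s dx i)"
proof -
  have "koszul coeff_partial (function_form V) $ U = (\<Sum>i\<in>UNIV. coeff_partial i V *s dx i) $ U" for U
  proof -
    have "koszul coeff_partial (function_form V) $ U = (\<Sum>i\<in>U. if U = {i} then coeff_partial i V else 0)"
      by (auto simp: koszul_def function_form_def axis_def
          additive.zero[OF additive_coeff_partial] intro!: sum.cong)
    also have "\<dots> = (\<Sum>i\<in>UNIV. if U = {i} then coeff_partial i V else 0)"
      by (rule sum.mono_neutral_left) auto
    finally show ?thesis by (auto simp: dx_def axis_def intro!: sum.cong)
  qed
  then show ?thesis by (simp add: de_Rham_eq_koszul vec_eq_iff)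
qed

definition df_coeff ::
    "'k::comm_ring_1 ^ 'n::{finite,linorder} ^ 'n::{finite,linorder} \<Rightarrow> ('n, 'k) coeffs \<Rightarrow> 'n \<Rightarrow> ('n, 'k) coeffs" where
  "df_coeff A V i = fps_const (linear_form A i) + fps_X * coeff_partial i V"

lemma df_eq: "df A V = (\<Sum>i\<in>UNIV. df_coeff A V i *s dx i)"
proof -
  have add: "Modules.additive fps_const" by standard simp
  show ?thesis
    by (simp add: df_def df0_def de_Rham_function_form df_coeff_def linear_form_def vec_eq_iff
        additive.sum[OF add] sum_distrib_left sum_distrib_right distrib_right sum.distrib mult.assoc)
qed

lemma twisted_d_eq_koszul:
  "twisted_d A V = koszul (\<lambda>i g. coeff_partial i g + df_coeff A V i * g)"
  by (simp add: fun_eq_iff twisted_d_def de_Rham_eq_koszul df_eq wedge_one_form koszul_def vec_eq_iff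
      distrib_left sum.distrib)

lemma additive_coeff_partial_plus_mult: "Modules.additive (\<lambda>g. coeff_partial i g + a * g)"
  by standard (simp add: additive.add[OF additive_coeff_partial] distrib_left)

lemma twisted_d_add: "twisted_d A V (\<rho> + \<sigma>) = twisted_d A V \<rho> + twisted_d A V \<sigma>"
  unfolding twisted_d_eq_koszul by (rule koszul_add) (rule additive_coeff_partial_plus_mult)

lemma twisted_d_diff: "twisted_d A V (\<rho> - \<sigma>) = twisted_d A V \<rho> - twisted_d A V \<sigma>"
  unfolding twisted_d_eq_koszul by (rule koszul_diff) (rule additive_coeff_partial_plus_mult)

lemma twisted_d_top_form: "twisted_d A V (axis UNIV g) = 0"
  unfolding twisted_d_eq_koszul by (rule koszul_axis_UNIV) (rule additive_coeff_partial_plus_mult)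

lemma coeff_partial_fps_const: "coeff_partial i (fps_const p) = fps_const (mpoly_partial i p)"
  by (simp add: fps_eq_iff additive.zero[OF additive_partial])

lemma twisted_d_square:
  assumes "transpose A = A"
  shows "twisted_d A V (twisted_d A V \<rho>) = 0"
proof -
  have "coeff_partial i (df_coeff A V j) = coeff_partial j (df_coeff A V i)" for i j
    using coeff_partial_commute[of i j V] symmetric_entries[OF assms, of i j]
    by (simp add: df_coeff_def additive.add[OF additive_coeff_partial] coeff_partial_mult
        coeff_partial_X coeff_partial_fps_const partial_linear_form)
  then show ?thesis
    unfolding twisted_d_eq_koszul
    by (intro koszul_koszul additive_coeff_partial_plus_mult derivation_plus_mult_commute)
      (simp_all add: additive_coeff_partial coeff_partial_mult coeff_partial_commute)
qed

lemma twisted_d_scale: "twisted_d A V (scale_form c \<rho>) = scale_form c (twisted_d A V \<rho>)"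
proof -
  have scale: "scale_form c \<sigma> = map_form ((*) (embed_scalar c)) \<sigma>" for \<sigma> :: "('a, 'b) forms"
    by (simp add: scale_form_def vec_eq_iff)
  show ?thesis
    unfolding scale twisted_d_eq_koszul
    by (rule map_form_koszul[symmetric])
      (simp_all add: additive_mult coeff_partial_mult algebra_simps)
qed

abbreviation constant_term :: "('n, 'k::comm_ring_1) coeffs ^ 'i \<Rightarrow> ('n, 'k) mpoly ^ 'i" where
  "constant_term \<equiv> map_form (\<lambda>g. fps_nth g 0)"

lemma constant_term_twisted_d: "constant_term (twisted_d A V \<rho>) = quadratic_d A (constant_term \<rho>)"
  unfolding twisted_d_eq_koszul quadratic_d_def
  by (rule map_form_koszul) (simp_all add: df_coeff_def Modules.additive_def)

text \<open>
  Scaling by the power series variable is multiplication by \<open>\<lambda>\<close>, as in the following lemmas.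
\<close>
lemma divide_lambda:
  assumes "constant_term \<rho> = 0"
  shows "\<rho> = scale_form fps_X (map_form (fps_shift 1) \<rho>)"
proof -
  have "\<rho> $ S = fps_X * fps_shift 1 (\<rho> $ S)" for S
    using assms by (intro fps_ext) (auto simp: vec_eq_iff)
  then show ?thesis by (simp add: vec_eq_iff scale_form_def embed_scalar_X)
qed

lemma scale_X_cancel: "scale_form fps_X \<rho> = scale_form fps_X \<sigma> \<Longrightarrow> \<rho> = \<sigma>"
proof -
  assume *: "scale_form fps_X \<rho> = scale_form fps_X \<sigma>"
  have "fps_X * \<rho> $ S = fps_X * \<sigma> $ S" for S
    using arg_cong[OF *, of "\<lambda>\<tau>. \<tau> $ S"] by (simp add: scale_form_def embed_scalar_X)
  then have "fps_nth (\<rho> $ S) k = fps_nth (\<sigma> $ S) k" for S k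
    by (metis fps_X_mult_nth nat.distinct(1) diff_Suc_1)
  then show ?thesis by (simp add: vec_eq_iff fps_eq_iff)
qed

text \<open>
  One step of the expansion in powers of \<open>\<lambda>\<close>.  The hypothesis says that the constant term of \<open>\<rho>\<close> is closed for
  \<open>d + df\<^sub>0\<close>; up to a multiple of the volume form it is then exact, and removing these two contributions from
  \<open>\<rho>\<close> leaves a multiple of \<open>\<lambda>\<close>.  As in the descent on the degree, the
  differential of \<open>\<rho>\<close> is only asked to vanish in lowest order, so that the step applies both to
  closed forms and to primitives of multiples of the volume form.
\<close>
lemma twisted_d_lambda_step:
  fixes A :: "'k::comm_ring_1 ^ 'n::{finite,linorder} ^ 'n::{finite,linorder}"
  assumes A: "transpose A = A" "invertible A" and "constant_term (twisted_d A V \<rho>) = 0"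
  shows "\<exists>c k \<sigma>. \<rho> = axis UNIV (embed_scalar (fps_const c)) + twisted_d A V (map_form fps_const k) + scale_form fps_X \<sigma>
    \<and> twisted_d A V \<rho> = scale_form fps_X (twisted_d A V \<sigma>)"
proof -
  have "quadratic_d A (constant_term \<rho>) = 0"
    using assms(3) by (simp add: constant_term_twisted_d)
  from quadratic_d_exact[OF A this] obtain c k where
    ck: "constant_term \<rho> = axis UNIV (const_poly c) + quadratic_d A k" by blast
  define \<tau> where "\<tau> = \<rho> - axis UNIV (embed_scalar (fps_const c)) - twisted_d A V (map_form fps_const k)"
  define \<sigma> where "\<sigma> = map_form (fps_shift 1) \<tau>"
  have add: "Modules.additive (\<lambda>g :: ('n, 'k) coeffs. fps_nth g 0)" by standard simp
  have "constant_term (map_form fps_const k) = k" by (simp add: vec_eq_iff)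
  then have "constant_term \<tau> = 0"
    by (simp add: \<tau>_def map_form_diff[OF add] constant_term_twisted_d ck)
  then have \<tau>: "\<tau> = scale_form fps_X \<sigma>" unfolding \<sigma>_def by (rule divide_lambda)
  then have "\<rho> = axis UNIV (embed_scalar (fps_const c)) + twisted_d A V (map_form fps_const k) + scale_form fps_X \<sigma>"
    unfolding \<tau>_def by (simp add: algebra_simps)
  moreover have "twisted_d A V \<rho> = twisted_d A V \<tau>"
    by (simp add: \<tau>_def twisted_d_diff twisted_d_top_form twisted_d_square A)
  ultimately show ?thesis using \<tau> by (metis twisted_d_scale)
qed

text \<open>
  The constant term of \<open>c\<close> vanishes by the case \<open>\<lambda> = 0\<close>.  The primitive can then be replaced by a multiple of
  \<open>\<lambda>\<close>, and dividing the equation by \<open>\<lambda>\<close> gives the same statement for the next coefficient.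
\<close>
lemma twisted_d_volume:
  fixes A :: "'k::comm_ring_1 ^ 'n::{finite,linorder} ^ 'n::{finite,linorder}"
  assumes A: "transpose A = A" "invertible A" and "twisted_d A V \<rho> = axis UNIV (embed_scalar c)"
  shows "c = 0"
proof -
  have lowest: "fps_nth c 0 = 0" if "twisted_d A V \<rho> = axis UNIV (embed_scalar c)" for c \<rho>
    using arg_cong[OF that, of constant_term] quadratic_d_volume[OF A]
    by (simp add: constant_term_twisted_d)
  have "fps_nth c k = 0" if "twisted_d A V \<rho> = axis UNIV (embed_scalar c)" for c k \<rho>
    using that
  proof (induction k arbitrary: c \<rho>)
    case 0
    then show ?case by (rule lowest)
  next
    case (Suc k)
    have "constant_term (twisted_d A V \<rho>) = 0"
      using lowest[OF Suc.prems] by (simp add: Suc.prems vec_eq_iff axis_def)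
    from twisted_d_lambda_step[OF A this] obtain \<sigma> where
      \<sigma>: "twisted_d A V \<rho> = scale_form fps_X (twisted_d A V \<sigma>)" by blast
    have "c = fps_X * fps_shift 1 c"
      using lowest[OF Suc.prems] by (intro fps_ext) auto
    then have "embed_scalar c = fps_X * (embed_scalar (fps_shift 1 c) :: ('n, 'k) coeffs)"
      by (metis embed_scalar_mult embed_scalar_X)
    then have "axis UNIV (embed_scalar c) = scale_form fps_X (axis UNIV (embed_scalar (fps_shift 1 c)) :: ('n, 'k) forms)"
      by (simp add: scale_form_def vec_eq_iff axis_def embed_scalar_X)
    then have "twisted_d A V \<sigma> = axis UNIV (embed_scalar (fps_shift 1 c))"
      using \<sigma> Suc.prems by (metis scale_X_cancel)
    from Suc.IH[OF this] show ?case by simp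
  qed
  then show ?thesis using assms(3) by (auto simp: fps_eq_iff)
qed

text \<open>
  Iterating the step on a closed form \<open>\<rho>\<close> produces closed remainders \<open>r\<^sup>j \<rho>\<close> and contributions \<open>c\<^sub>j\<close>, \<open>k\<^sub>j\<close>, which
  are assembled into the power series \<open>\<Sum>\<^sub>j c\<^sub>j \<lambda>\<^sup>j\<close> and \<open>\<Sum>\<^sub>j k\<^sub>j \<lambda>\<^sup>j\<close>.
\<close>
lemma twisted_d_exact:
  fixes A :: "'k::comm_ring_1 ^ 'n::{finite,linorder} ^ 'n::{finite,linorder}"
  assumes A: "transpose A = A" "invertible A" and closed: "twisted_d A V \<rho> = 0"
  shows "\<exists>c h. \<rho> = axis UNIV (embed_scalar c) + twisted_d A V h"
proof -
  let ?D = "twisted_d A V"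
  have X0: "\<tau> = 0" if "scale_form fps_X \<tau> = 0" for \<tau> :: "('n, 'k) forms"
    using that scale_X_cancel[of \<tau> 0] by (simp add: scale_form_def vec_eq_iff)
  have "\<forall>\<rho>. \<exists>c k \<sigma>. ?D \<rho> = 0 \<longrightarrow>
      \<rho> = axis UNIV (embed_scalar (fps_const c)) + ?D (map_form fps_const k) + scale_form fps_X \<sigma> \<and> ?D \<sigma> = 0"
  proof (intro allI)
    fix \<rho>
    show "\<exists>c k \<sigma>. ?D \<rho> = 0 \<longrightarrow>
      \<rho> = axis UNIV (embed_scalar (fps_const c)) + ?D (map_form fps_const k) + scale_form fps_X \<sigma> \<and> ?D \<sigma> = 0"
    proof (cases "?D \<rho> = 0")
      case True
      then have "constant_term (?D \<rho>) = 0" by (simp add: vec_eq_iff)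
      from twisted_d_lambda_step[OF A this] True X0 show ?thesis by metis
    qed simp
  qed
  then obtain c k r where step: "\<And>\<rho>. ?D \<rho> = 0 \<Longrightarrow>
      \<rho> = axis UNIV (embed_scalar (fps_const (c \<rho>))) + ?D (map_form fps_const (k \<rho>)) + scale_form fps_X (r \<rho>)"
    and closed_r: "\<And>\<rho>. ?D \<rho> = 0 \<Longrightarrow> ?D (r \<rho>) = 0"
    by metis
  define C where "C \<rho> = Abs_fps (\<lambda>j. c ((r ^^ j) \<rho>))" for \<rho>
  define G :: "('n, 'k) forms \<Rightarrow> ('n, 'k) forms"
    where "G \<rho> = (\<chi> S. Abs_fps (\<lambda>j. k ((r ^^ j) \<rho>) $ S))" for \<rho>
  have C: "C \<rho> = fps_const (c \<rho>) + fps_X * C (r \<rho>)" for \<rho>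
  proof (rule fps_ext)
    show "fps_nth (C \<rho>) j = fps_nth (fps_const (c \<rho>) + fps_X * C (r \<rho>)) j" for j
      by (cases j) (simp_all add: C_def funpow_swap1)
  qed
  have G: "G \<rho> = map_form fps_const (k \<rho>) + scale_form fps_X (G (r \<rho>))" for \<rho>
  proof -
    have "fps_nth (G \<rho> $ S) j = fps_nth ((map_form fps_const (k \<rho>) + scale_form fps_X (G (r \<rho>))) $ S) j" for S j
      by (cases j) (simp_all add: G_def funpow_swap1 scale_form_def embed_scalar_X)
    then show ?thesis by (simp add: vec_eq_iff fps_eq_iff)
  qed
  \<comment> \<open>The total error satisfies \<open>E \<rho> = \<lambda> E (r \<rho>)\<close>, so it is divisible by every power of \<open>\<lambda>\<close>.\<close>
  define E where "E \<rho> = \<rho> - axis UNIV (embed_scalar (C \<rho>)) - ?D (G \<rho>)" for \<rho>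
  have E: "E \<rho> = scale_form fps_X (E (r \<rho>))" if "?D \<rho> = 0" for \<rho>
  proof -
    have "axis UNIV (embed_scalar (C \<rho>)) =
        axis UNIV (embed_scalar (fps_const (c \<rho>))) + scale_form fps_X (axis UNIV (embed_scalar (C (r \<rho>))) :: ('n, 'k) forms)"
      by (subst C) (simp add: vec_eq_iff axis_def scale_form_def embed_scalar_add embed_scalar_mult)
    moreover have "?D (G \<rho>) = ?D (map_form fps_const (k \<rho>)) + scale_form fps_X (?D (G (r \<rho>)))"
      by (subst G) (simp add: twisted_d_add twisted_d_scale)
    moreover have "scale_form fps_X (\<alpha> - \<beta> - \<gamma>) = scale_form fps_X \<alpha> - scale_form fps_X \<beta> - scale_form fps_X \<gamma>"
      for \<alpha> \<beta> \<gamma> :: "('n, 'k) forms"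
      by (simp add: scale_form_def vec_eq_iff right_diff_distrib)
    ultimately show ?thesis
      using step[OF that] unfolding E_def by (simp add: algebra_simps)
  qed
  have "fps_nth (E \<rho> $ S) j = 0" if "?D \<rho> = 0" for \<rho> S j
    using that
  proof (induction j arbitrary: \<rho>)
    case 0
    then show ?case using arg_cong[OF E[OF 0], of "\<lambda>\<tau>. fps_nth (\<tau> $ S) 0"]
      by (simp add: scale_form_def embed_scalar_X)
  next
    case (Suc j)
    then show ?case using arg_cong[OF E[OF Suc.prems], of "\<lambda>\<tau>. fps_nth (\<tau> $ S) (Suc j)"] closed_r
      by (simp add: scale_form_def embed_scalar_X)
  qed
  then have "E \<rho> = 0" using closed by (simp add: vec_eq_iff fps_eq_iff)
  then have "\<rho> = axis UNIV (embed_scalar (C \<rho>)) + ?D (G \<rho>)" by (simp add: E_def algebra_simps)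
  then show ?thesis by blast
qed

section \<open>Integral functionals\<close>

lemma wedge_dx_basis:
  assumes "\<And>j. j \<in> T \<Longrightarrow> i < j"
  shows "dx i \<and>\<^sub>\<Omega> axis T 1 = axis (insert i T) 1"
proof -
  have "i \<notin> T" using assms by blast
  moreover have "koszul_sign i (insert i T) = 1"
  proof -
    have "\<not> j < i" if "j \<in> insert i T" for j using assms[of j] that by auto
    then have "{j \<in> insert i T. j < i} = {}" by blast
    then show ?thesis by (simp only: koszul_sign_def card.empty power_0)
  qed
  ultimately show ?thesis
    unfolding wedge_dx vec_eq_iff by (auto simp: axis_def)
qed

lemma volume_form_eq: "volume_form = (axis UNIV 1 :: ('n::{finite,linorder}, 'k::comm_ring_1) forms)"
proof -
  have "foldr (\<lambda>i \<omega>. dx i \<and>\<^sub>\<Omega> \<omega>) xs (function_form 1) = (axis (set xs) 1 :: ('n, 'k) forms)"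
    if "sorted_wrt (<) xs" for xs
    using that by (induction xs) (simp_all add: function_form_def wedge_dx_basis)
  then show ?thesis by (simp add: volume_form_def)
qed

lemma scale_volume_form: "scale_form c volume_form = axis UNIV (embed_scalar c)"
  by (simp add: scale_form_def volume_form_eq vec_eq_iff axis_def)

theorem mainTheorem1:
  fixes A :: "'k::comm_ring_1 ^ 'n::{finite,linorder} ^ 'n::{finite,linorder}"
    and V :: "('n, 'k) coeffs"
  assumes "transpose A = A"
    and "invertible A"
  shows "\<exists>I0 \<in> integral_functionals A V.
           I0 volume_form = 1 \<and>
           (\<forall>J \<in> integral_functionals A V. J volume_form = 1 \<longrightarrow> J = I0) \<and>
           (\<forall>I \<in> integral_functionals A V.
              \<exists>c. \<forall>\<rho> \<in> twisted_closed A V. I \<rho> = c * I0 \<rho>)"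
proof -
  let ?D = "twisted_d A V" and ?Z = "twisted_closed A V"
  have D_closed: "?D h \<in> ?Z" for h
    by (simp add: twisted_closed_def twisted_d_square assms)
  have volume_closed: "scale_form c volume_form \<in> ?Z" for c
    by (simp add: twisted_closed_def scale_volume_form twisted_d_top_form)
  have decompose: "\<exists>c h. \<rho> = scale_form c volume_form + ?D h" if "\<rho> \<in> ?Z" for \<rho>
    using twisted_d_exact[OF assms] that by (simp add: twisted_closed_def scale_volume_form)
  have unique: "c = c'" if eq: "scale_form c volume_form + ?D h = scale_form c' volume_form + ?D h'" for c c' h h'
  proof -
    have "?D (h' - h) = scale_form c volume_form - scale_form c' volume_form"
      using eq by (simp add: twisted_d_diff algebra_simps)
    also have "\<dots> = axis UNIV (embed_scalar (c - c'))"
      by (simp add: scale_volume_form vec_eq_iff axis_def fps_eq_iff single_diff)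
    finally have "?D (h' - h) = axis UNIV (embed_scalar (c - c'))" .
    from twisted_d_volume[OF assms this] show ?thesis by simp
  qed
  define I0 where "I0 = restrict (\<lambda>\<rho>. THE c. \<exists>h. \<rho> = scale_form c volume_form + ?D h) ?Z"
  have I0: "I0 (scale_form c volume_form + ?D h) = c" for c h
  proof -
    have "scale_form c volume_form + ?D h \<in> ?Z"
      using volume_closed[of c] D_closed[of h] by (simp add: twisted_closed_def twisted_d_add)
    moreover have "(THE c'. \<exists>h'. scale_form c volume_form + ?D h = scale_form c' volume_form + ?D h') = c"
      by (rule the_equality) (use unique in blast)+
    ultimately show ?thesis by (simp add: I0_def)
  qed
  have scale_add: "scale_form (c + d) \<rho> = scale_form c \<rho> + scale_form d \<rho>" for c d and \<rho> :: "('n, 'k) forms"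
    by (simp add: scale_form_def vec_eq_iff embed_scalar_add distrib_right)
  have scale_scale: "scale_form c (scale_form d \<rho>) = scale_form (c * d) \<rho>" for c d and \<rho> :: "('n, 'k) forms"
    by (simp add: scale_form_def vec_eq_iff embed_scalar_mult mult.assoc)
  have scale_right: "scale_form c (\<rho> + \<sigma>) = scale_form c \<rho> + scale_form c \<sigma>" for c and \<rho> \<sigma> :: "('n, 'k) forms"
    by (simp add: scale_form_def vec_eq_iff distrib_left)
  have D0: "?D 0 = 0" using twisted_d_diff[of A V 0 0] by simp
  have I0_in: "I0 \<in> integral_functionals A V"
    unfolding integral_functionals_def
  proof (intro CollectI conjI allI ballI)
    show "I0 \<in> extensional ?Z" by (simp add: I0_def)
    show "I0 (\<rho> + \<sigma>) = I0 \<rho> + I0 \<sigma>" if "\<rho> \<in> ?Z" "\<sigma> \<in> ?Z" for \<rho> \<sigma>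
    proof -
      obtain c h where \<rho>: "\<rho> = scale_form c volume_form + ?D h" using decompose \<open>\<rho> \<in> ?Z\<close> by blast
      obtain d g where \<sigma>: "\<sigma> = scale_form d volume_form + ?D g" using decompose \<open>\<sigma> \<in> ?Z\<close> by blast
      have "\<rho> + \<sigma> = scale_form (c + d) volume_form + ?D (h + g)"
        by (simp add: \<rho> \<sigma> scale_add twisted_d_add)
      then show ?thesis using I0 \<rho> \<sigma> by metis
    qed
    show "I0 (scale_form c \<rho>) = c * I0 \<rho>" if "\<rho> \<in> ?Z" for c \<rho>
    proof -
      obtain d h where \<rho>: "\<rho> = scale_form d volume_form + ?D h"
        using decompose[OF \<open>\<rho> \<in> ?Z\<close>] by blast
      have "scale_form c \<rho> = scale_form (c * d) volume_form + ?D (scale_form c h)"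
        by (simp add: \<rho> scale_right scale_scale twisted_d_scale)
      then show ?thesis using I0 \<rho> by metis
    qed
    show "I0 (?D h) = 0" for h
      using I0[of 0 h] by (simp add: scale_form_def)
  qed
  have scalar: "I \<rho> = I volume_form * I0 \<rho>" if I: "I \<in> integral_functionals A V" and "\<rho> \<in> ?Z" for I \<rho>
  proof -
    obtain c h where \<rho>: "\<rho> = scale_form c volume_form + ?D h" using decompose \<open>\<rho> \<in> ?Z\<close> by blast
    have "volume_form \<in> ?Z" using volume_closed[of 1] by (simp add: scale_form_def)
    then have "I \<rho> = c * I volume_form"
      using I volume_closed D_closed unfolding \<rho> by (simp add: integral_functionals_def)
    then show ?thesis by (simp add: \<rho> I0 mult.commute)
  qed
  show ?thesis
  proof (intro bexI[OF _ I0_in] conjI ballI impI)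
    show "I0 volume_form = 1"
      using I0[of 1 0] by (simp add: D0 scale_form_def)
    show "J = I0" if J: "J \<in> integral_functionals A V" "J volume_form = 1" for J
    proof (rule extensionalityI)
      show "J \<in> extensional ?Z" "I0 \<in> extensional ?Z"
        using J(1) I0_in by (simp_all add: integral_functionals_def)
      show "J \<rho> = I0 \<rho>" if "\<rho> \<in> ?Z" for \<rho>
        using scalar[OF J(1) that] J(2) by simp
    qed
    show "\<exists>c. \<forall>\<rho>\<in>?Z. I \<rho> = c * I0 \<rho>" if "I \<in> integral_functionals A V" for I
      using scalar[OF that] by blast
  qed
qed

end
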